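(* Let $\mathcal{L}=\langle L,\mathcal{F},\mathcal{P}\rangle$ be a computation states structure (as defined in the context) with $\mathcal{P}$ at most countable. Let $f\in\mathcal{F}$ be unary, $f:L\to L$, such that $L$ is the union of $f$-stable generalized closed disks. Let $L[\bar r]$ be an $f$-stable generalized closed disk and let $f^*:L[\bar r]\to L[\bar r]$ be a deep equilibrium for $f$ on $L[\bar r]$. Then for every countable set $V\subseteq L[\bar r]$ there exist a countable set $\tilde V$ with $V\subseteq\tilde V\subseteq L[\bar r]$ and a sequence $(f^{n_k})_{k\in\mathbb{N}}$ of iterates of $f$ such that, for all $v\in\tilde V$, $f(v)\in\tilde V$ and $f^*(v)=\lim_{k\to\infty}f^{n_k}(v)\in\tilde V$ (limit in the type topology).
   Context: A computation states structure (CSS) is a triple $\mathcal{L}=\langle L,\mathcal{F},\mathcal{P}\rangle$ where $L$ is a set, $\mathcal{F}$ is a collection of functions $L^n\to L$ (of various arities) closed under composition, and $\mathcal{P}$ is a collection of functions $P:L\to\mathbb{R}$ ("predicates"). The type topology on $L$ is induced by the pseudometrics $d_P(v,w)=|P(v)-P(w)|$, $P\in\mathcal{P}$; states with identical predicate values are identified. Standing hypotheses: every $f\in\mathcal{F}$ is continuous in the type topology, and $L$ is complete with respect to the pseudometrics $(d_P)_{P\in\mathcal{P}}$. For $\bar r=(r_P)_{P\in\mathcal{P}}$ with $r_P\ge0$, the generalized closed disk is $L[\bar r]=\{v\in L:|P(v)|\le r_P\ \forall P\in\mathcal{P}\}$; it is $f$-stable if $f(L[\bar r])\subseteq L[\bar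 r]$. A deep equilibrium for $f$ on an $f$-stable disk $L[\bar r]$ is a map $f^*:L[\bar r]\to L[\bar r]$ with $f^*\circ f^*=f^*$ which is the pointwise limit (in the type topology on $L[\bar r]$) of some net $(f^{m_i})_{i\in I}$ of iterates $f^{m}=f\circ\cdots\circ f$ ($m\ge1$) of $f$. *)

theory Defs
  imports "HOL-Analysis.Analysis"
begin

definition pred_dist :: "('a \<Rightarrow> real) \<Rightarrow> 'a \<Rightarrow> 'a \<Rightarrow> real" where
  "pred_dist P v w = \<bar>P v - P w\<bar>"

text \<open>The open balls of the pseudometrics form a subbase. The set \<open>L\<close> is added explicitly so
  that the carrier of the topology is \<open>L\<close> even when there are no predicates.\<close>

definition type_topology :: "'a set \<Rightarrow> ('a \<Rightarrow> real) set \<Rightarrow> 'a topology" where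
  "type_topology L \<P> = topology_generated_by
     (insert L {{v \<in> L. pred_dist P w v < e} | P w e. P \<in> \<P> \<and> w \<in> L \<and> 0 < e})"

lemma topspace_type_topology: "topspace (type_topology L \<P>) = L"
  unfolding type_topology_def topology_generated_by_topspace by auto

text \<open>Completeness of \<open>L\<close> for the uniformity induced by the whole family of pseudometrics:
  every proper Cauchy filter on \<open>L\<close> converges in \<open>L\<close> (cf. the library constant
  \<open>complete\<close> of the class of uniform spaces). Membership of the limit in \<open>L\<close> is part
  of \<open>limitin\<close>.\<close>

definition pred_cauchy_filter :: "('a \<Rightarrow> real) set \<Rightarrow> 'a filter \<Rightarrow> bool" where
  "pred_cauchy_filter \<P> G \<longleftrightarrow>
     (\<forall>P\<in>\<P>. \<forall>e>0. eventually (\<lambda>(v, w). pred_dist P v w < e) (G \<times>\<^sub>F G))"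

definition pred_complete :: "'a set \<Rightarrow> ('a \<Rightarrow> real) set \<Rightarrow> bool" where
  "pred_complete L \<P> \<longleftrightarrow>
     (\<forall>G \<le> principal L. G \<noteq> bot \<longrightarrow> pred_cauchy_filter \<P> G \<longrightarrow>
        (\<exists>l. limitin (type_topology L \<P>) (\<lambda>v. v) l G))"

text \<open>Tuples are extensional functions on \<open>{..<n}\<close>, i.e. the points of the \<open>n\<close>-fold
  product topology.\<close>

definition tuples :: "'a set \<Rightarrow> nat \<Rightarrow> (nat \<Rightarrow> 'a) set" where
  "tuples L n = (\<Pi>\<^sub>E i\<in>{..<n}. L)"

text \<open>\<open>\<F> n\<close> is the set of members of the collection that have arity \<open>n\<close>. All functions
  (transitions and predicates) are extensional, so that equality of HOL functions is
  equality of functions on their domain. Composition is superposition of an \<open>n\<close>-ary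
  function with \<open>n\<close> functions of a common arity \<open>m\<close>.\<close>

locale computation_states_structure =
  fixes L :: "'a set"
    and \<F> :: "nat \<Rightarrow> ((nat \<Rightarrow> 'a) \<Rightarrow> 'a) set"
    and \<P> :: "('a \<Rightarrow> real) set"
  assumes transitions: "\<And>n. \<F> n \<subseteq> (tuples L n \<rightarrow>\<^sub>E L)"
    and composition: "\<And>n m g h. \<lbrakk>0 < n; g \<in> \<F> n; \<And>i. i < n \<Longrightarrow> h i \<in> \<F> m\<rbrakk> \<Longrightarrow>
          (\<lambda>x\<in>tuples L m. g (\<lambda>i\<in>{..<n}. h i x)) \<in> \<F> m"
    and predicates: "\<P> \<subseteq> extensional L"
    and separated: "\<And>v w. \<lbrakk>v \<in> L; w \<in> L; \<And>P. P \<in> \<P> \<Longrightarrow> P v = P w\<rbrakk> \<Longrightarrow> v = w"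
    and continuous: "\<And>n g. g \<in> \<F> n \<Longrightarrow>
          continuous_map (product_topology (\<lambda>_. type_topology L \<P>) {..<n}) (type_topology L \<P>) g"
    and complete: "pred_complete L \<P>"

text \<open>Identification of a map \<open>L \<rightarrow> L\<close> with a function on 1-tuples.\<close>

definition as_unary :: "'a set \<Rightarrow> ('a \<Rightarrow> 'a) \<Rightarrow> (nat \<Rightarrow> 'a) \<Rightarrow> 'a" where
  "as_unary L f = (\<lambda>x\<in>tuples L 1. f (x 0))"

definition gen_disk :: "'a set \<Rightarrow> ('a \<Rightarrow> real) set \<Rightarrow> (('a \<Rightarrow> real) \<Rightarrow> real) \<Rightarrow> 'a set" where
  "gen_disk L \<P> r = {v \<in> L. \<forall>P\<in>\<P>. \<bar>P v\<bar> \<le> r P}"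

definition stable_disk ::
  "'a set \<Rightarrow> ('a \<Rightarrow> real) set \<Rightarrow> ('a \<Rightarrow> 'a) \<Rightarrow> (('a \<Rightarrow> real) \<Rightarrow> real) \<Rightarrow> bool" where
  "stable_disk L \<P> f r \<longleftrightarrow> (\<forall>P\<in>\<P>. 0 \<le> r P) \<and> f ` gen_disk L \<P> r \<subseteq> gen_disk L \<P> r"

definition directed_preorder :: "'i set \<Rightarrow> 'i rel \<Rightarrow> bool" where
  "directed_preorder I le \<longleftrightarrow> I \<noteq> {} \<and> preorder_on I le \<and>
     (\<forall>i\<in>I. \<forall>j\<in>I. \<exists>k\<in>I. (i, k) \<in> le \<and> (j, k) \<in> le)"

text \<open>The filter of tails of a directed index set; convergence along it is convergence of nets.\<close>

definition net_filter :: "'i set \<Rightarrow> 'i rel \<Rightarrow> 'i filter" where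
  "net_filter I le = (INF i\<in>I. principal {j \<in> I. (i, j) \<in> le})"

lemma eventually_net_filter:
  assumes "directed_preorder I le"
  shows "eventually Q (net_filter I le) \<longleftrightarrow> (\<exists>i\<in>I. \<forall>j\<in>I. (i, j) \<in> le \<longrightarrow> Q j)"
proof -
  have tr: "trans le" and ne: "I \<noteq> {}"
    using assms by (auto simp: directed_preorder_def preorder_on_def)
  have "\<exists>k\<in>I. principal {j \<in> I. (k, j) \<in> le} \<le>
          inf (principal {l \<in> I. (i, l) \<in> le}) (principal {l \<in> I. (j, l) \<in> le})"
    if ij: "i \<in> I" "j \<in> I" for i j
  proof -
    obtain k where k: "k \<in> I" "(i, k) \<in> le" "(j, k) \<in> le"
      using assms ij by (auto simp: directed_preorder_def)
    then show ?thesis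
      using tr by (intro bexI[of _ k]) (auto dest: transD)
  qed
  then have "eventually Q (net_filter I le) \<longleftrightarrow>
      (\<exists>i\<in>I. eventually Q (principal {j \<in> I. (i, j) \<in> le}))"
    unfolding net_filter_def by (intro eventually_INF_base ne)
  then show ?thesis
    by (auto simp: eventually_principal)
qed

text \<open>The index type of the net cannot be quantified existentially inside a definition; it is
  passed as a type argument. With a free type variable for it, a deep equilibrium
  appearing as a hypothesis is the limit of a net over an arbitrary directed set.\<close>

definition deep_equilibrium ::
  "'i itself \<Rightarrow> 'a set \<Rightarrow> ('a \<Rightarrow> real) set \<Rightarrow> ('a \<Rightarrow> 'a) \<Rightarrow> (('a \<Rightarrow> real) \<Rightarrow> real) \<Rightarrow>
     ('a \<Rightarrow> 'a) \<Rightarrow> bool" where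
  "deep_equilibrium _ L \<P> f r fs \<longleftrightarrow>
     fs \<in> gen_disk L \<P> r \<rightarrow> gen_disk L \<P> r \<and>
     (\<forall>v\<in>gen_disk L \<P> r. fs (fs v) = fs v) \<and>
     (\<exists>(I :: 'i set) le (m :: 'i \<Rightarrow> nat).
        directed_preorder I le \<and> (\<forall>i\<in>I. 1 \<le> m i) \<and>
        (\<forall>v\<in>gen_disk L \<P> r.
           limitin (subtopology (type_topology L \<P>) (gen_disk L \<P> r))
             (\<lambda>i. (f ^^ m i) v) (fs v) (net_filter I le)))"

end

theory Submission
  imports Defs
begin

text \<open>A countable \<open>V\<close> has a countable closure under \<open>f\<close> and \<open>f\<^sup>*\<close>. As there are
  only countably many pairs of a point of this closure and a predicate, a diagonal choice from the
  net of iterates yields a sequence along which every predicate converges at every point.\<close>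

lemma countable_pointwise_limit_sequence:
  fixes h :: "'b \<Rightarrow> 'i \<Rightarrow> 'c::metric_space"
  assumes "F \<noteq> bot" and "countable X" and Q: "eventually Q F"
    and lim: "\<And>x. x \<in> X \<Longrightarrow> (h x \<longlongrightarrow> l x) F"
  shows "\<exists>s :: nat \<Rightarrow> 'i. (\<forall>k. Q (s k)) \<and> (\<forall>x\<in>X. (\<lambda>k. h x (s k)) \<longlonglongrightarrow> l x)"
proof -
  obtain e :: "'b \<Rightarrow> nat" where e: "inj_on e X"
    using \<open>countable X\<close> by (auto simp: countable_def)
  \<comment> \<open>Stage \<open>k\<close> of the diagonal choice deals only with the points of code
    at most \<open>k\<close>. There are finitely many of these, because \<open>e\<close> is
    injective on \<open>X\<close>, so their closeness conditions hold eventually all at once. As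
    \<open>F\<close> is proper, some index satisfies them together with \<open>Q\<close>.\<close>
  define Y where "Y k = {x \<in> X. e x \<le> k}" for k
  have fin: "finite (Y k)" for k
    by (rule inj_on_finite[of e _ "{..k}"]) (use e in \<open>auto simp: Y_def inj_on_def\<close>)
  have "\<exists>i. Q i \<and> (\<forall>x\<in>Y k. dist (h x i) (l x) < inverse (real (Suc k)))" for k
  proof -
    have "eventually (\<lambda>i. \<forall>x\<in>Y k. dist (h x i) (l x) < inverse (real (Suc k))) F"
      using fin lim by (intro eventually_ball_finite ballI tendstoD) (auto simp: Y_def)
    then show ?thesis
      using eventually_happens'[OF \<open>F \<noteq> bot\<close> eventually_conj[OF Q]] by blast
  qed
  then have "\<exists>s. \<forall>k. Q (s k) \<and> (\<forall>x\<in>Y k. dist (h x (s k)) (l x) < inverse (real (Suc k)))"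
    by (intro choice) blast
  then obtain s where s: "Q (s k)" "x \<in> Y k \<Longrightarrow> dist (h x (s k)) (l x) < inverse (real (Suc k))"
    for k x by blast
  show ?thesis
  proof (intro exI[of _ s] conjI allI ballI)
    fix x assume "x \<in> X"
    \<comment> \<open>The point \<open>x\<close> lies in \<open>Y k\<close> from stage
      \<open>e x\<close> on; the stages before that say nothing about it.\<close>
    have "eventually (\<lambda>k. dist (h x (s k)) (l x) \<le> inverse (real (Suc k))) sequentially"
      using eventually_ge_at_top[of "e x"]
      by eventually_elim (use s(2) \<open>x \<in> X\<close> in \<open>auto simp: Y_def intro: less_imp_le\<close>)
    then show "(\<lambda>k. h x (s k)) \<longlonglongrightarrow> l x"
      by (intro metric_tendsto_imp_tendsto[OF LIMSEQ_inverse_real_of_nat]) (simp add: dist_real_def)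
  qed (rule s)
qed

text \<open>Convergence can be tested on a subbase: the property that \<open>l \<in> U\<close>
  forces \<open>x\<close> to be eventually in \<open>U\<close> passes to finite intersections and
  arbitrary unions. The subbasic sets are \<open>L\<close> itself, which the hypothesis on
  \<open>x\<close> settles, and the balls of the pseudometrics.\<close>

lemma limitin_type_topology:
  assumes "\<And>i. x i \<in> L"
  shows "limitin (type_topology L \<P>) x l F \<longleftrightarrow> l \<in> L \<and> (\<forall>P\<in>\<P>. ((\<lambda>i. P (x i)) \<longlongrightarrow> P l) F)"
    (is "?lhs \<longleftrightarrow> ?rhs")
proof
  assume lhs: ?lhs
  then have l: "l \<in> L"
    by (auto simp: limitin_def topspace_type_topology)
  moreover have "((\<lambda>i. P (x i)) \<longlongrightarrow> P l) F" if "P \<in> \<P>" for P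
  proof (rule tendstoI)
    fix e :: real assume "0 < e"
    then have "openin (type_topology L \<P>) {v \<in> L. pred_dist P l v < e}"
      unfolding type_topology_def using l \<open>P \<in> \<P>\<close> by (intro topology_generated_by_Basis) blast
    then have "eventually (\<lambda>i. x i \<in> {v \<in> L. pred_dist P l v < e}) F"
      using lhs l \<open>0 < e\<close> by (auto simp: limitin_def pred_dist_def)
    then show "eventually (\<lambda>i. dist (P (x i)) (P l) < e) F"
      by eventually_elim (simp add: pred_dist_def dist_real_def abs_minus_commute)
  qed
  ultimately show ?rhs by blast
next
  assume rhs: ?rhs
  let ?S = "insert L {{v \<in> L. pred_dist P w v < e} | P w e. P \<in> \<P> \<and> w \<in> L \<and> 0 < e}"
  have "eventually (\<lambda>i. x i \<in> U) F" if "generate_topology_on ?S U" "l \<in> U" for U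
    using that
  proof induction
    case (Int A B)
    then show ?case by (simp add: eventually_conj)
  next
    case (UN K)
    then obtain A where "A \<in> K" "eventually (\<lambda>i. x i \<in> A) F" by blast
    then show ?case by (auto elim: eventually_mono)
  next
    case (Basis U)
    then consider "U = L"
      | P w e where "U = {v \<in> L. pred_dist P w v < e}" "P \<in> \<P>" by blast
    then show ?case
    proof cases
      case 1
      then show ?thesis using assms by simp
    next
      case (2 P w e)
      \<comment> \<open>The centre \<open>w\<close> need not be \<open>l\<close>. The distance to
        \<open>w\<close> converges to its value at \<open>l\<close>, which is strictly below
        \<open>e\<close>, so it is eventually below \<open>e\<close>.\<close>
      then have "((\<lambda>i. \<bar>P w - P (x i)\<bar>) \<longlongrightarrow> \<bar>P w - P l\<bar>) F"
        using rhs by (intro tendsto_intros) blast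
      then show ?thesis
        using 2 assms Basis(2) by (auto simp: pred_dist_def dest: order_tendstoD(2))
    qed
  qed simp
  then show ?lhs
    using rhs topspace_type_topology[of L \<P>]
    by (auto simp: limitin_def type_topology_def openin_topology_generated_by_iff)
qed

text \<open>The layer \<open>A n\<close> collects the images of \<open>V\<close> under all words of
  length \<open>n\<close> in \<open>f\<close> and \<open>g\<close>. Each layer is countable, and
  both maps send layer \<open>n\<close> into layer \<open>n + 1\<close>, so the union of the layers
  is closed.\<close>

lemma countable_closure_under_two_maps:
  assumes "countable V" and "V \<subseteq> D" and "f \<in> D \<rightarrow> D" and "g \<in> D \<rightarrow> D"
  obtains W where "countable W" and "V \<subseteq> W" and "W \<subseteq> D" and "f \<in> W \<rightarrow> W" and "g \<in> W \<rightarrow> W"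
proof -
  define A where "A n = ((\<lambda>B. f ` B \<union> g ` B) ^^ n) V" for n
  have A: "A 0 = V" "A (Suc n) = f ` A n \<union> g ` A n" for n
    by (simp_all add: A_def)
  have "countable (A n) \<and> A n \<subseteq> D" for n
    by (induction n) (use assms A in auto)
  then have "countable (\<Union>n. A n)" "(\<Union>n. A n) \<subseteq> D"
    by (simp_all add: UN_least)
  moreover have "V \<subseteq> (\<Union>n. A n)"
    using A(1) by blast
  moreover have "f x \<in> (\<Union>n. A n) \<and> g x \<in> (\<Union>n. A n)" if x: "x \<in> (\<Union>n. A n)" for x
  proof -
    obtain n where "x \<in> A n" using x by blast
    then have "f x \<in> A (Suc n)" "g x \<in> A (Suc n)" by (simp_all add: A)
    then show ?thesis by blast
  qed
  ultimately show thesis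
    by (intro that[of "\<Union>n. A n"] Pi_I) simp_all
qed

theorem theorem2p7:
  fixes L :: "'a set"
    and \<F> :: "nat \<Rightarrow> ((nat \<Rightarrow> 'a) \<Rightarrow> 'a) set"
    and \<P> :: "('a \<Rightarrow> real) set"
    and f fs :: "'a \<Rightarrow> 'a"
    and r :: "('a \<Rightarrow> real) \<Rightarrow> real"
    and V :: "'a set"
  assumes "computation_states_structure L \<F> \<P>"
    and "countable \<P>"
    and "f \<in> L \<rightarrow> L"
    and "as_unary L f \<in> \<F> 1"
    and "L = \<Union>{gen_disk L \<P> s | s. stable_disk L \<P> f s}"
    and "stable_disk L \<P> f r"
    and "deep_equilibrium TYPE('i) L \<P> f r fs"
    and "countable V"
    and "V \<subseteq> gen_disk L \<P> r"
  shows "\<exists>V'. countable V' \<and> V \<subseteq> V' \<and> V' \<subseteq> gen_disk L \<P> r \<and>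
           (\<exists>n :: nat \<Rightarrow> nat. (\<forall>k. 1 \<le> n k) \<and>
              (\<forall>v\<in>V'. f v \<in> V' \<and>
                 limitin (type_topology L \<P>) (\<lambda>k. (f ^^ n k) v) (fs v) sequentially \<and>
                 fs v \<in> V'))"
proof -
  let ?D = "gen_disk L \<P> r" and ?T = "type_topology L \<P>"
  have fD: "f \<in> ?D \<rightarrow> ?D"
    using \<open>stable_disk L \<P> f r\<close> by (auto simp: stable_disk_def)
  have DL: "?D \<subseteq> L" by (auto simp: gen_disk_def)
  obtain I :: "'i set" and le and m :: "'i \<Rightarrow> nat"
    where fsD: "fs \<in> ?D \<rightarrow> ?D" and dir: "directed_preorder I le" and m: "\<And>i. i \<in> I \<Longrightarrow> 1 \<le> m i"
      and lim: "\<And>v. v \<in> ?D \<Longrightarrow>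
        limitin (subtopology ?T ?D) (\<lambda>i. (f ^^ m i) v) (fs v) (net_filter I le)"
    using \<open>deep_equilibrium TYPE('i) L \<P> f r fs\<close> unfolding deep_equilibrium_def by blast
  \<comment> \<open>\<open>W\<close> is fixed before any sequence is chosen. Closure under
    \<open>fs\<close> puts the limits in \<open>W\<close> whatever the sequence will be.\<close>
  obtain W where W: "countable W" "V \<subseteq> W" "W \<subseteq> ?D" "f \<in> W \<rightarrow> W" "fs \<in> W \<rightarrow> W"
    using countable_closure_under_two_maps[OF \<open>countable V\<close> \<open>V \<subseteq> ?D\<close> fD fsD] .
  \<comment> \<open>This covers every exponent, hence also \<open>m i\<close> for \<open>i\<close>
    outside \<open>I\<close>, as \<open>limitin_type_topology\<close> asks for all indices.\<close>
  have iter: "(f ^^ j) v \<in> L" if "v \<in> ?D" for j v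
  proof -
    have "(f ^^ j) v \<in> ?D" using that fD by (induction j) auto
    then show ?thesis using DL by blast
  qed
  \<comment> \<open>Indexing by pairs of a point and a predicate turns convergence on
    \<open>W\<close> into countably many real limits; countability of \<open>\<P>\<close> enters
    here.\<close>
  define h where "h = (\<lambda>(v, P) i. P ((f ^^ m i) v) :: real)"
  \<comment> \<open>By reflexivity each index lies in its own tail, so no tail is empty.\<close>
  have ne: "net_filter I le \<noteq> bot"
    using dir by (auto simp: trivial_limit_def eventually_net_filter directed_preorder_def
        preorder_on_def refl_on_def)
  have ctbl: "countable (W \<times> \<P>)"
    using W(1) \<open>countable \<P>\<close> by blast
  \<comment> \<open>This serves as the side condition \<open>Q\<close> of the diagonal choice:
    indices taken from \<open>I\<close> have exponents at least 1.\<close>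
  have inI: "eventually (\<lambda>i. i \<in> I) (net_filter I le)"
    using dir by (auto simp: eventually_net_filter directed_preorder_def)
  have hlim: "(h x \<longlongrightarrow> (case x of (v, P) \<Rightarrow> P (fs v))) (net_filter I le)"
    if xW: "x \<in> W \<times> \<P>" for x
  proof -
    obtain v P where x: "x = (v, P)" "v \<in> ?D" "P \<in> \<P>"
      using xW W(3) by blast
    have "limitin ?T (\<lambda>i. (f ^^ m i) v) (fs v) (net_filter I le)"
      using lim[OF x(2)] by (simp add: limitin_subtopology)
    then show ?thesis
      using x iter by (simp add: limitin_type_topology h_def)
  qed
  \<comment> \<open>The indices \<open>s k\<close> need not be cofinal in \<open>I\<close>; only the
    limits along them matter.\<close>
  obtain s where s: "\<forall>k. s k \<in> I"
    and conv: "\<forall>x\<in>W \<times> \<P>. (\<lambda>k. h x (s k)) \<longlonglongrightarrow> (case x of (v, P) \<Rightarrow> P (fs v))"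
    using countable_pointwise_limit_sequence[where h = h and l = "\<lambda>(v, P). P (fs v)",
        OF ne ctbl inI hlim] by blast
  have "limitin ?T (\<lambda>k. (f ^^ m (s k)) v) (fs v) sequentially" if "v \<in> W" for v
  proof -
    have v: "v \<in> ?D" "fs v \<in> L" using that W(3) fsD DL by auto
    moreover have "(\<lambda>k. P ((f ^^ m (s k)) v)) \<longlonglongrightarrow> P (fs v)" if "P \<in> \<P>" for P
      using bspec[OF conv, of "(v, P)"] \<open>v \<in> W\<close> that by (simp add: h_def)
    ultimately show ?thesis
      using iter by (simp add: limitin_type_topology)
  qed
  moreover have "f v \<in> W" "fs v \<in> W" if "v \<in> W" for v
    using that W(4,5) by blast+
  ultimately have "\<forall>v\<in>W. f v \<in> W \<and>
      limitin ?T (\<lambda>k. (f ^^ m (s k)) v) (fs v) sequentially \<and> fs v \<in> W"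
    by blast
  moreover have "\<forall>k. 1 \<le> m (s k)"
    using m s by blast
  ultimately show ?thesis
    using W(1,2,3) by (intro exI[of _ W] conjI exI[of _ "\<lambda>k. m (s k)"])
qed

end
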